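(* Let $\mathcal{Q}$ be a family of measures describing an uncertain location parameter: $\mathcal{Q}$ is parameterized by $\mu_Q=E_Q[X]\in\mathbb{R}$, and under $Q\in\mathcal{Q}$ the random variables $X,\{X_n\}_{n=1}^N$ are iid observations from a distribution with density $x\mapsto\exp(-\Psi(x-\mu_Q))$. Suppose $\Psi$ has monotone increasing derivative $\psi$ (which may be discontinuous) and, writing $\psi(\pm\infty)=\lim_{x\to\pm\infty}\psi(x)$, that $-\infty\le\psi(-\infty)<0<\psi(\infty)\le\infty$. Let $k>0$ and $\beta\in\mathbb{R}$. If $\psi(-\infty)<\pm\beta/N<\psi(\infty)$ (for both choices of sign), then the nonlinear expectation $\mathcal{E}^{k,1}_{\mathcal{Q}|\mathbf{x}_N}(\beta X)$ is finite, and has breakdown fraction at least $$\delta=\min\Big\{\frac{\psi(\infty)-|\beta|/N}{\psi(\infty)-\psi(-\infty)},\ \frac{-|\beta|/N-\psi(-\infty)}{\psi(\infty)-\psi(-\infty)}\Big\}.$$ That is, for $m/N<\delta$, at least $m$ observations can be made arbitrarily large or small while $\mathcal{E}^{k,1}_{\mathcal{Q}|\mathbf{x}_N}(\beta X)$ remains bounded.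
   Context: Write $\mathbf{x}_N=(X_1,\dots,X_N)$ for the observations and $L(Q|\mathbf{x}_N)=\prod_{n=1}^N\exp(-\Psi(X_n-\mu_Q))$ for the likelihood. The divergence is $\alpha_{\mathcal{Q}|\mathbf{x}_N}(Q)=-\log L(Q|\mathbf{x}_N)+\sup_{\tilde Q\in\mathcal{Q}}\log L(\tilde Q|\mathbf{x}_N)$. For an uncertainty aversion parameter $k>0$, the divergence-robust expectation with exponent $1$ is $\mathcal{E}^{k,1}_{\mathcal{Q}|\mathbf{x}_N}(\eta)=\sup_{Q\in\mathcal{Q}}\{E_Q[\eta|\mathbf{x}_N]-\frac1k\alpha_{\mathcal{Q}|\mathbf{x}_N}(Q)\}$; for $\eta=\beta X$, with $X$ independent of $\mathbf{x}_N$ under each $Q$, one has $E_Q[\eta|\mathbf{x}_N]=\beta\mu_Q$. The maximum likelihood parameter, assumed to exist for simplicity, is the solution $\mu$ of $\sum_n\psi(X_n-\mu)=0$. The breakdown statement means: for a set $M\subseteq\{1,\dots,N\}$ of $m$ indices with $m/N<\delta$, the value $\mathcal{E}^{k,1}_{\mathcal{Q}|\mathbf{x}_N(M,y)}(\beta X)$ is bounded uniformly over $y$, where $\mathbf{x}_N(M,y)$ is $\mathbf{x}_N$ with $X_i$ replaced by $y_i$ for $i\in M$. If $\psi(\infty)=\infty$ or $\psi(-\infty)=-\infty$, $\delta$ is read as $0$.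
   Formalization: β/N is replaced by kβ/N in the hypothesis and |β|/N by k|β|/N in δ; as stated the claim fails for k>1 (N=1, β=1, k=2, Laplace with ψ=(3/2)sgn gives an infinite expectation), while for k≤1 the proved version implies it. *)

theory Defs
  imports "HOL-Probability.Probability"
begin

text \<open>
  \<open>X 0\<close> is the variable to be predicted (written \<open>X\<close> in the mathematics) and \<open>X 1, \<dots>, X N\<close> are
  the observations. A sample \<open>x :: nat \<Rightarrow> real\<close> is only ever inspected at the indices \<open>1, \<dots>, N\<close>.
\<close>

definition loc_param :: "(nat \<Rightarrow> 'w \<Rightarrow> real) \<Rightarrow> 'w measure \<Rightarrow> real" where
  "loc_param X Q = (\<integral>\<omega>. X 0 \<omega> \<partial>Q)"

text \<open>
  All measures of the family live on the measurable space of \<open>\<Omega>\<close> (only \<open>sets \<Omega>\<close> is used).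
\<close>

definition location_family ::
  "'w measure \<Rightarrow> 'w measure set \<Rightarrow> (nat \<Rightarrow> 'w \<Rightarrow> real) \<Rightarrow> nat \<Rightarrow> (real \<Rightarrow> real) \<Rightarrow> bool" where
  "location_family \<Omega> \<Q> X N \<Psi> \<longleftrightarrow>
     bij_betw (loc_param X) \<Q> UNIV \<and>
     (\<forall>Q\<in>\<Q>. sets Q = sets \<Omega> \<and> prob_space Q \<and> integrable Q (X 0) \<and>
        prob_space.indep_vars Q (\<lambda>_. borel) X {0..N} \<and>
        (\<forall>n\<in>{0..N}. distributed Q lborel (X n) (\<lambda>t. ennreal (exp (- \<Psi> (t - loc_param X Q))))))"

text \<open>
  An everywhere existing monotone derivative is automatically continuous, so a possibly
  discontinuous monotone \<open>\<psi>\<close> can only be the derivative of \<open>\<Psi>\<close> at its points of continuity (all but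
  countably many points). Together with the continuity of \<open>\<Psi>\<close> this makes \<open>\<Psi>\<close> a primitive of \<open>\<psi>\<close>;
  for instance \<open>\<psi> = sgn\<close>, \<open>\<Psi> t = \<bar>t\<bar> + ln 2\<close> (the Laplace family) is included.
\<close>

definition monotone_derivative :: "(real \<Rightarrow> real) \<Rightarrow> (real \<Rightarrow> real) \<Rightarrow> bool" where
  "monotone_derivative \<Psi> \<psi> \<longleftrightarrow>
     mono \<psi> \<and> continuous_on UNIV \<Psi> \<and>
     (\<forall>t. isCont \<psi> t \<longrightarrow> (\<Psi> has_real_derivative \<psi> t) (at t))"

definition likelihood ::
  "(real \<Rightarrow> real) \<Rightarrow> (nat \<Rightarrow> 'w \<Rightarrow> real) \<Rightarrow> nat \<Rightarrow> (nat \<Rightarrow> real) \<Rightarrow> 'w measure \<Rightarrow> real" where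
  "likelihood \<Psi> X N x Q = (\<Prod>n=1..N. exp (- \<Psi> (x n - loc_param X Q)))"

definition divergence ::
  "(real \<Rightarrow> real) \<Rightarrow> (nat \<Rightarrow> 'w \<Rightarrow> real) \<Rightarrow> nat \<Rightarrow> 'w measure set \<Rightarrow> (nat \<Rightarrow> real) \<Rightarrow>
     'w measure \<Rightarrow> ereal" where
  "divergence \<Psi> X N \<Q> x Q =
     - ereal (ln (likelihood \<Psi> X N x Q)) + (SUP Q'\<in>\<Q>. ereal (ln (likelihood \<Psi> X N x Q')))"

definition sample_vector :: "(nat \<Rightarrow> 'w \<Rightarrow> real) \<Rightarrow> nat \<Rightarrow> 'w \<Rightarrow> nat \<Rightarrow> real" where
  "sample_vector X N \<omega> = (\<lambda>n\<in>{1..N}. X n \<omega>)"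

definition sample_algebra ::
  "(nat \<Rightarrow> 'w \<Rightarrow> real) \<Rightarrow> nat \<Rightarrow> 'w measure \<Rightarrow> 'w measure" where
  "sample_algebra X N Q =
     vimage_algebra (space Q) (sample_vector X N) (Pi\<^sub>M {1..N} (\<lambda>_. borel))"

text \<open>
  \<open>E\<^sub>Q[\<eta> | x\<^sub>N]\<close> evaluated at the sample \<open>x\<close>. A conditional expectation is a function of the sample
  determined only up to null sets, whereas it is needed here at every single (contaminated) sample
  and for all \<open>Q\<close> simultaneously. As usual the continuous version is meant; the observations have
  an everywhere positive joint density, so there is at most one.
\<close>

definition cond_expectation_at ::
  "(nat \<Rightarrow> 'w \<Rightarrow> real) \<Rightarrow> nat \<Rightarrow> 'w measure \<Rightarrow> ('w \<Rightarrow> real) \<Rightarrow> (nat \<Rightarrow> real) \<Rightarrow> real" where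
  "cond_expectation_at X N Q \<eta> x =
     (THE c. \<exists>g. continuous_on ({1..N} \<rightarrow>\<^sub>E UNIV) g \<and>
        (AE \<omega> in Q. real_cond_exp Q (sample_algebra X N Q) \<eta> \<omega> = g (sample_vector X N \<omega>)) \<and>
        c = g (restrict x {1..N}))"

definition robust_expectation ::
  "(real \<Rightarrow> real) \<Rightarrow> (nat \<Rightarrow> 'w \<Rightarrow> real) \<Rightarrow> nat \<Rightarrow> 'w measure set \<Rightarrow> real \<Rightarrow> ('w \<Rightarrow> real) \<Rightarrow>
     (nat \<Rightarrow> real) \<Rightarrow> ereal" where
  "robust_expectation \<Psi> X N \<Q> k \<eta> x =
     (SUP Q\<in>\<Q>. ereal (cond_expectation_at X N Q \<eta> x) - ereal (1 / k) * divergence \<Psi> X N \<Q> x Q)"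

definition contaminate :: "(nat \<Rightarrow> real) \<Rightarrow> nat set \<Rightarrow> (nat \<Rightarrow> real) \<Rightarrow> nat \<Rightarrow> real" where
  "contaminate x M y = (\<lambda>n. if n \<in> M then y n else x n)"

definition breakdown_fraction_at_least ::
  "nat \<Rightarrow> ((nat \<Rightarrow> real) \<Rightarrow> ereal) \<Rightarrow> (nat \<Rightarrow> real) \<Rightarrow> real \<Rightarrow> bool" where
  "breakdown_fraction_at_least N T x \<delta> \<longleftrightarrow>
     (\<forall>M. M \<subseteq> {1..N} \<and> real (card M) / real N < \<delta> \<longrightarrow>
        (\<exists>B::real. \<forall>y. \<bar>T (contaminate x M y)\<bar> \<le> ereal B))"

text \<open>
  The breakdown bound, where \<open>a = \<psi>(-\<infinity>)\<close>, \<open>b = \<psi>(\<infinity>)\<close> and \<open>s\<close> is the slope per observation contributed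
  by the payoff: up to a constant the robust expectation maximises
  \<open>\<beta> * \<mu> - (\<Sum>n=1..N. \<Psi> (x n - \<mu>)) / k\<close> over \<open>\<mu>\<close>, whose slope is a positive multiple of
  \<open>k * \<beta> / N + (\<Sum>n=1..N. \<psi> (x n - \<mu>)) / N\<close>, so \<open>s = k * \<bar>\<beta>\<bar> / N\<close>. The \<open>k\<close> may be omitted for \<open>k \<le> 1\<close>
  but not beyond: for \<open>N = 1\<close>, \<open>\<beta> = 1\<close>, \<open>k = 2\<close> and \<open>\<Psi> t = 3/2 * \<bar>t\<bar> - ln (3/4)\<close> the supremum is infinite
  although \<open>\<bar>\<beta>\<bar> / N = 1 < 3/2\<close>.
\<close>

definition breakdown_bound :: "ereal \<Rightarrow> ereal \<Rightarrow> real \<Rightarrow> real" where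
  "breakdown_bound a b s =
     (if a = -\<infinity> \<or> b = \<infinity> then 0
      else min ((real_of_ereal b - s) / (real_of_ereal b - real_of_ereal a))
               ((- s - real_of_ereal a) / (real_of_ereal b - real_of_ereal a)))"

end

theory Submission
  imports Defs
begin

text \<open>
  Put \<open>f \<mu> = (\<Sum>n=1..N. \<Psi> (z n - \<mu>))\<close> for a sample \<open>z\<close>. Since the conditional expectation is the constant
  \<open>\<beta> \<mu>\<close>, the robust expectation is \<open>SUP \<mu>. \<beta> \<mu> - (f \<mu> - inf f) / k\<close>. If the score sum
  \<open>\<Sum>n. \<psi> (z n - \<mu>)\<close> is at most \<open>- k \<bar>\<beta>\<bar>\<close> at \<open>\<mu> = K\<close> and at least \<open>k \<bar>\<beta>\<bar>\<close> at \<open>\<mu> = - K\<close>, then outside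
  \<open>[-K, K]\<close> the function \<open>f\<close> grows at least as fast as \<open>k \<bar>\<beta> \<mu>\<bar>\<close>, and the robust expectation lies between
  \<open>- \<bar>\<beta>\<bar> K\<close> and \<open>\<bar>\<beta>\<bar> K\<close>. The \<open>m\<close> contaminated observations contribute at most \<open>m \<psi>(\<infinity>)\<close> to the score sum
  and the others contribute almost \<open>(N - m) \<psi>(-\<infinity>)\<close> for large \<open>\<mu>\<close>, so \<open>K\<close> can be chosen uniformly in the
  contamination as soon as \<open>m \<psi>(\<infinity>) + (N - m) \<psi>(-\<infinity>) < - k \<bar>\<beta>\<bar>\<close>, and symmetrically; this is \<open>m / N < \<delta>\<close>.
\<close>

section \<open>Increments of a primitive of a monotone score\<close>

lemma nonpos_derivative_off_countable:
  fixes f :: "real \<Rightarrow> real"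
  assumes "a \<le> b" and cont: "continuous_on {a..b} f" and S: "countable S"
    and der: "\<And>t. t \<in> {a..b} - S \<Longrightarrow> \<exists>d\<le>0. (f has_real_derivative d) (at t)"
  shows "f b \<le> f a"
proof (rule ccontr)
  txt \<open>
    Tilting by \<open>e\<close> makes the derivative strictly negative off \<open>S\<close>. As \<open>h ` S\<close> is countable, some level \<open>y\<close>
    between \<open>h a\<close> and \<open>h b\<close> is not attained on \<open>S\<close>; at the last point where \<open>h\<close> attains \<open>y\<close> it cannot be
    decreasing.
  \<close>
  assume "\<not> f b \<le> f a"
  then have fab: "f a < f b" and ab: "a < b" using \<open>a \<le> b\<close> by (auto simp: less_le)
  \<comment> \<open>Half the mean slope of \<open>f\<close>: the tilt removes only half of the
    increase, so \<open>h a < h b\<close> survives.\<close>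
  define e where "e = (f b - f a) / (b - a) / 2"
  have e: "e > 0" using fab ab by (simp add: e_def)
  define h where "h = (\<lambda>t. f t - e * t)"
  have "e * (b - a) = ((f b - f a) / (b - a) * (b - a)) / 2" unfolding e_def by (simp only: times_divide_eq_left)
  also have "\<dots> = (f b - f a) / 2" using ab by simp
  finally have hab: "h a < h b" using fab by (simp add: h_def algebra_simps)
  have conth: "continuous_on {a..b} h" unfolding h_def by (intro continuous_intros cont)
  have "\<not> {h a<..<h b} \<subseteq> h ` S"
    using S hab uncountable_open_interval countable_subset countable_image by metis
  then obtain y where "y \<in> {h a<..<h b}" and "y \<notin> h ` S" by blast
  then have y: "h a < y" "y < h b" "y \<notin> h ` S" by auto
  have "compact ({a..b} \<inter> h -` {y})"
    using continuous_closed_preimage[OF conth, of "{y}"]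
    by (auto simp: compact_eq_bounded_closed bounded_Int)
  moreover have "{a..b} \<inter> h -` {y} \<noteq> {}"
    using IVT'[of h a y b] y ab conth by auto
  ultimately obtain t where "t \<in> {a..b} \<inter> h -` {y}" "\<forall>s\<in>{a..b} \<inter> h -` {y}. s \<le> t"
    using compact_attains_sup by blast
  then have t: "t \<in> {a..b}" "h t = y" and tmax: "\<And>s. s \<in> {a..b} \<Longrightarrow> h s = y \<Longrightarrow> s \<le> t"
    by auto
  have "t \<notin> S" and "t < b" using t y by (auto simp: less_le)
  then obtain d where d: "d \<le> 0" "(f has_real_derivative d) (at t)" using der[of t] t by blast
  have "(h has_real_derivative d - e) (at t)"
    unfolding h_def using d by (auto intro!: derivative_eq_intros)
  then obtain r where r: "r > 0" "\<And>s. 0 < s \<Longrightarrow> s < r \<Longrightarrow> h (t + s) < h t"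
    using DERIV_neg_dec_right[of h "d - e" t] d e by auto
  define s where "s = t + min (r / 2) (b - t)"
  have s: "t < s" "s \<le> b" "h s < y"
    using r(1) r(2)[of "min (r / 2) (b - t)"] t \<open>t < b\<close> by (auto simp: s_def)
  have "continuous_on {s..b} h" using conth s t by (auto elim!: continuous_on_subset)
  then obtain s' where "s \<le> s'" "s' \<le> b" "h s' = y"
    using IVT'[of h s y b] s y by auto
  then show False using tmax[of s'] s t by auto
qed

lemma monotone_derivative_bounds:
  assumes "monotone_derivative \<Psi> \<psi>" and uv: "u \<le> v"
  shows "\<Psi> v - \<Psi> u \<le> \<psi> v * (v - u)" and "\<psi> u * (v - u) \<le> \<Psi> v - \<Psi> u"
proof -
  have mono: "mono \<psi>" and cont: "continuous_on UNIV \<Psi>"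
    and der: "\<And>t. isCont \<psi> t \<Longrightarrow> (\<Psi> has_real_derivative \<psi> t) (at t)"
    using assms(1) by (auto simp: monotone_derivative_def)
  let ?S = "{t. \<not> isCont \<psi> t}"
  have S: "countable ?S" by (rule mono_ctble_discont[OF mono])
  have cont': "continuous_on {u..v} \<Psi>" using cont continuous_on_subset by blast
  have "\<Psi> v - \<psi> v * v \<le> \<Psi> u - \<psi> v * u"
  proof (rule nonpos_derivative_off_countable[OF uv _ S])
    fix t assume "t \<in> {u..v} - ?S"
    then have "((\<lambda>t. \<Psi> t - \<psi> v * t) has_real_derivative \<psi> t - \<psi> v) (at t)" "\<psi> t - \<psi> v \<le> 0"
      using der[of t] monoD[OF mono, of t v] by (auto intro!: derivative_eq_intros)
    then show "\<exists>d\<le>0. ((\<lambda>t. \<Psi> t - \<psi> v * t) has_real_derivative d) (at t)" by blast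
  qed (intro continuous_intros cont')
  then show "\<Psi> v - \<Psi> u \<le> \<psi> v * (v - u)" by (simp add: algebra_simps)
  have "\<psi> u * v - \<Psi> v \<le> \<psi> u * u - \<Psi> u"
  proof (rule nonpos_derivative_off_countable[OF uv _ S])
    fix t assume "t \<in> {u..v} - ?S"
    then have "((\<lambda>t. \<psi> u * t - \<Psi> t) has_real_derivative \<psi> u - \<psi> t) (at t)" "\<psi> u - \<psi> t \<le> 0"
      using der[of t] monoD[OF mono, of u t] by (auto intro!: derivative_eq_intros)
    then show "\<exists>d\<le>0. ((\<lambda>t. \<psi> u * t - \<Psi> t) has_real_derivative d) (at t)" by blast
  qed (intro continuous_intros cont')
  then show "\<psi> u * (v - u) \<le> \<Psi> v - \<Psi> u" by (simp add: algebra_simps)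
qed

section \<open>Conditional expectations evaluated at a sample\<close>

text \<open>Every event of the generated sigma-algebra is the preimage of some \<open>B\<close>
  under \<open>Z\<close>. Independence splits the integral of \<open>\<phi> (W \<omega>)\<close>
  over it into a product, which is the integral of the constant.\<close>

lemma (in prob_space) real_cond_exp_indep:
  fixes \<phi> :: "'b \<Rightarrow> real"
  assumes ind: "indep_var M'' W M' Z" and \<phi>: "\<phi> \<in> borel_measurable M''"
    and int: "integrable M (\<lambda>\<omega>. \<phi> (W \<omega>))"
  shows "AE \<omega> in M. real_cond_exp M (vimage_algebra (space M) Z M') (\<lambda>\<omega>. \<phi> (W \<omega>)) \<omega> =
    expectation (\<lambda>\<omega>. \<phi> (W \<omega>))"
proof -
  define Y where "Y = (\<lambda>\<omega>. \<phi> (W \<omega>))"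
  let ?F = "vimage_algebra (space M) Z M'"
  have Z: "Z \<in> measurable M M'" using indep_var_rv2[OF ind] .
  have setsF: "sets ?F = {Z -` A \<inter> space M |A. A \<in> sets M'}"
    using measurable_space[OF Z] by (intro sets_vimage_algebra2) auto
  have sub: "subalgebra M ?F"
    using Z by (auto simp: subalgebra_def setsF measurable_sets)
  interpret finite_measure_subalgebra M ?F
    by unfold_locales (rule sub)
  show ?thesis
    unfolding Y_def[symmetric]
  proof (rule real_cond_exp_charact)
    fix A assume "A \<in> sets ?F"
    then obtain B where A: "A = Z -` B \<inter> space M" and B: "B \<in> sets M'" using setsF by auto
    have AM: "A \<in> events" using A B Z by (simp add: measurable_sets)
    have "indep_var borel (\<phi> \<circ> W) borel ((indicator B :: _ \<Rightarrow> real) \<circ> Z)"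
      using B by (intro indep_var_compose[OF ind \<phi>]) auto
    then have "indep_var borel Y borel (\<lambda>\<omega>. indicator B (Z \<omega>) :: real)" by (simp add: comp_def Y_def)
    moreover have "integrable M (\<lambda>\<omega>. indicator B (Z \<omega>) :: real)"
    proof (rule integrable_const_bound[where B = 1])
      show "(\<lambda>\<omega>. indicator B (Z \<omega>) :: real) \<in> borel_measurable M" using B Z by measurable
    qed auto
    ultimately have "(\<integral>\<omega>. Y \<omega> * indicator B (Z \<omega>) \<partial>M) = expectation Y * (\<integral>\<omega>. indicator B (Z \<omega>) \<partial>M)"
      using int by (intro indep_var_lebesgue_integral) (simp_all add: Y_def)
    moreover have "(\<integral>\<omega>. Y \<omega> * indicator B (Z \<omega>) \<partial>M) = (\<integral>\<omega>\<in>A. Y \<omega> \<partial>M)"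
      unfolding set_lebesgue_integral_def
      by (intro Bochner_Integration.integral_cong) (auto simp: A indicator_def)
    moreover have "(\<integral>\<omega>. indicator B (Z \<omega>) \<partial>M) = (\<integral>\<omega>. indicator A \<omega> \<partial>M :: real)"
      by (intro Bochner_Integration.integral_cong) (auto simp: A indicator_def)
    ultimately show "(\<integral>\<omega>\<in>A. Y \<omega> \<partial>M) = (\<integral>\<omega>\<in>A. expectation Y \<partial>M)"
      using AM by (simp add: set_lebesgue_integral_def mult.commute)
  qed (use int in \<open>auto simp: Y_def\<close>)
qed

lemma distributed_positive_density_open_interval:
  assumes d: "distributed M lborel Y (\<lambda>t. ennreal (f t))" and pos: "\<And>t. 0 < f t" and ab: "(a::real) < b"
  shows "emeasure M (Y -` {a<..<b} \<inter> space M) \<noteq> 0"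
proof
  assume "emeasure M (Y -` {a<..<b} \<inter> space M) = 0"
  then have "(\<integral>\<^sup>+ t. ennreal (f t) * indicator {a<..<b} t \<partial>lborel) = 0"
    using distributed_emeasure[OF d, of "{a<..<b}"] by simp
  moreover have "(\<lambda>t. ennreal (f t)) \<in> borel_measurable borel"
    using distributed_borel_measurable[OF d] by simp
  ultimately have "AE t in lborel. ennreal (f t) * indicator {a<..<b} t = 0"
    by (subst (asm) nn_integral_0_iff_AE) auto
  then have "AE t in lborel. t \<notin> {a<..<b}"
  proof eventually_elim
    fix t assume "ennreal (f t) * indicator {a<..<b} t = 0"
    then show "t \<notin> {a<..<b}" using pos[of t] by (auto simp: ennreal_eq_0_iff)
  qed
  then have "emeasure lborel {a<..<b} = 0"
    by (subst (asm) AE_iff_measurable[of "{a<..<b}"]) auto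
  then show False using ab by simp
qed

text \<open>By independence the probability of a box around \<open>x\<close> is a product of
  positive factors, so the box cannot lie in the exceptional null set of \<open>P\<close>.\<close>

lemma (in prob_space) AE_sample_dense:
  assumes ind: "indep_vars (\<lambda>_. borel) X {1..N::nat}"
    and pos: "\<And>n a b. n \<in> {1..N} \<Longrightarrow> a < b \<Longrightarrow> emeasure M (X n -` {a<..<b::real} \<inter> space M) \<noteq> 0"
    and P: "AE \<omega> in M. P \<omega>" and e: "e > 0"
  shows "\<exists>\<omega>. P \<omega> \<and> (\<forall>n\<in>{1..N}. \<bar>X n \<omega> - x n\<bar> < e)"
proof (cases "N = 0")
  \<comment> \<open>The product formula needs a nonempty index set. Here the distance condition is
    vacuous, and some outcome satisfies \<open>P\<close> because the whole space is not
    null.\<close>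
  case True
  have "\<exists>\<omega>. P \<omega>"
  proof (rule ccontr)
    assume "\<nexists>\<omega>. P \<omega>"
    then have "AE \<omega> in M. False" using P by simp
    then show False by simp
  qed
  then show ?thesis using True by simp
next
  case False
  let ?A = "\<lambda>n. {x n - e<..<x n + e}"
  have "prob (\<Inter>n\<in>{1..N}. X n -` ?A n \<inter> space M) = (\<Prod>n\<in>{1..N}. prob (X n -` ?A n \<inter> space M))"
    using False by (intro indep_varsD_finite[OF ind]) auto
  also have "\<dots> > 0"
    using pos e by (intro prod_pos) (auto simp: emeasure_eq_measure zero_less_measure_iff)
  finally have box: "prob (\<Inter>n\<in>{1..N}. X n -` ?A n \<inter> space M) > 0" .
  show ?thesis
  proof (rule ccontr)
    assume none: "\<not> ?thesis"
    have "\<omega> \<notin> (\<Inter>n\<in>{1..N}. X n -` ?A n \<inter> space M)" if "P \<omega>" for \<omega>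
      using none that by (force simp: abs_less_iff)
    then have "AE \<omega> in M. \<omega> \<notin> (\<Inter>n\<in>{1..N}. X n -` ?A n \<inter> space M)"
      by (rule eventually_mono[OF P])
    then have "prob (\<Inter>n\<in>{1..N}. X n -` ?A n \<inter> space M) = 0"
    proof (subst prob_eq_0)
      show "(\<Inter>n\<in>{1..N}. X n -` ?A n \<inter> space M) \<in> events"
        using ind False by (intro sets.finite_INT) (auto simp: indep_vars_def intro!: measurable_sets)
    qed
    with box show False by simp
  qed
qed

text \<open>Two continuous versions agree at samples converging to \<open>x\<close>, hence at
  \<open>x\<close> itself. This makes the definite description in \<open>cond_expectation_at\<close>
  meaningful.\<close>

lemma (in prob_space) continuous_version_unique:
  fixes g h :: "(nat \<Rightarrow> real) \<Rightarrow> real"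
  assumes ind: "indep_vars (\<lambda>_. borel) X {1..N}"
    and pos: "\<And>n a b. n \<in> {1..N} \<Longrightarrow> a < b \<Longrightarrow> emeasure M (X n -` {a<..<b} \<inter> space M) \<noteq> 0"
    and g: "continuous_on ({1..N} \<rightarrow>\<^sub>E UNIV) g" and h: "continuous_on ({1..N} \<rightarrow>\<^sub>E UNIV) h"
    and eq: "AE \<omega> in M. g (sample_vector X N \<omega>) = h (sample_vector X N \<omega>)"
  shows "g (restrict x {1..N}) = h (restrict x {1..N})"
proof -
  let ?E = "{1..N} \<rightarrow>\<^sub>E (UNIV :: real set)" and ?x = "restrict x {1..N}"
  have "\<exists>\<omega>. g (sample_vector X N \<omega>) = h (sample_vector X N \<omega>) \<and>
      (\<forall>n\<in>{1..N}. \<bar>X n \<omega> - x n\<bar> < 1 / real (Suc j))" for j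
    by (rule AE_sample_dense[OF ind pos eq]) auto
  then obtain w where w: "\<And>j. g (sample_vector X N (w j)) = h (sample_vector X N (w j))"
    and wx: "\<And>j n. n \<in> {1..N} \<Longrightarrow> \<bar>X n (w j) - x n\<bar> < 1 / real (Suc j)"
    by metis
  define z where "z = (\<lambda>j. sample_vector X N (w j))"
  have "(\<lambda>j. z j n) \<longlonglongrightarrow> ?x n" for n
  proof (cases "n \<in> {1..N}")
    case True
    have "(\<lambda>j. X n (w j) - x n) \<longlonglongrightarrow> 0"
      using wx[OF True] by (intro LIMSEQ_norm_0) auto
    then show ?thesis using True by (simp add: z_def sample_vector_def LIM_zero_iff)
  next
    case False
    \<comment> \<open>Off \<open>{1..N}\<close> both functions take the default value of
      \<open>restrict\<close>, so convergence holds in every coordinate of the product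
      topology.\<close>
    then have "(\<lambda>j. z j n) = (\<lambda>_. ?x n)" by (auto simp: z_def sample_vector_def)
    then show ?thesis by simp
  qed
  then have lim: "z \<longlonglongrightarrow> ?x"
    using limitin_componentwise[of "\<lambda>_. euclidean" UNIV z ?x sequentially]
    by (simp add: euclidean_product_topology)
  have zE: "z j \<in> ?E" for j by (simp add: z_def sample_vector_def)
  have "(\<lambda>j. g (z j)) \<longlonglongrightarrow> g ?x" "(\<lambda>j. h (z j)) \<longlonglongrightarrow> h ?x"
    using zE lim by (auto intro!: continuous_on_tendsto_compose[OF g] continuous_on_tendsto_compose[OF h])
  then show ?thesis using w LIMSEQ_unique by (simp add: z_def)
qed

lemma cond_expectation_at_location_family:
  assumes fam: "location_family \<Omega> \<Q> X N \<Psi>" and Q: "Q \<in> \<Q>"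
  shows "cond_expectation_at X N Q (\<lambda>\<omega>. \<beta> * X 0 \<omega>) x = \<beta> * loc_param X Q"
proof -
  have "prob_space Q" and int: "integrable Q (X 0)"
    and ind: "prob_space.indep_vars Q (\<lambda>_. borel) X {0..N}"
    and dist: "\<And>n. n \<in> {0..N} \<Longrightarrow>
      distributed Q lborel (X n) (\<lambda>t. ennreal (exp (- \<Psi> (t - loc_param X Q))))"
    using fam Q by (auto simp: location_family_def)
  interpret prob_space Q by fact
  have ind': "indep_vars (\<lambda>_. borel) X {1..N}"
    by (rule indep_vars_subset[OF ind]) auto
  have pos: "emeasure Q (X n -` {a<..<b} \<inter> space Q) \<noteq> 0" if "n \<in> {1..N}" "a < b" for n a b
    using that by (intro distributed_positive_density_open_interval[OF dist]) auto
  \<comment> \<open>The disjoint index blocks \<open>{0}\<close> and \<open>{1..N}\<close> separate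
    the predicted variable from the observations.\<close>
  have "indep_var (Pi\<^sub>M {0} (\<lambda>_. borel)) (\<lambda>\<omega>. restrict (\<lambda>i. X i \<omega>) {0})
      (Pi\<^sub>M {1..N} (\<lambda>_. borel)) (\<lambda>\<omega>. restrict (\<lambda>i. X i \<omega>) {1..N})"
    by (rule indep_var_restrict[OF ind]) auto
  from real_cond_exp_indep[OF this, of "\<lambda>z. \<beta> * z 0"]
  have ce: "AE \<omega> in Q. real_cond_exp Q (sample_algebra X N Q) (\<lambda>\<omega>. \<beta> * X 0 \<omega>) \<omega> = \<beta> * loc_param X Q"
    using int by (simp add: sample_algebra_def loc_param_def sample_vector_def[abs_def])
  show ?thesis
    unfolding cond_expectation_at_def
  proof (rule the_equality)
    show "\<exists>g. continuous_on ({1..N} \<rightarrow>\<^sub>E UNIV) g \<and>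
        (AE \<omega> in Q. real_cond_exp Q (sample_algebra X N Q) (\<lambda>\<omega>. \<beta> * X 0 \<omega>) \<omega> = g (sample_vector X N \<omega>)) \<and>
        \<beta> * loc_param X Q = g (restrict x {1..N})"
      using ce by (intro exI[of _ "\<lambda>_. \<beta> * loc_param X Q"]) auto
  next
    fix c
    assume "\<exists>g. continuous_on ({1..N} \<rightarrow>\<^sub>E UNIV) g \<and>
        (AE \<omega> in Q. real_cond_exp Q (sample_algebra X N Q) (\<lambda>\<omega>. \<beta> * X 0 \<omega>) \<omega> = g (sample_vector X N \<omega>)) \<and>
        c = g (restrict x {1..N})"
    then obtain g where g: "continuous_on ({1..N} \<rightarrow>\<^sub>E UNIV) g"
      "AE \<omega> in Q. real_cond_exp Q (sample_algebra X N Q) (\<lambda>\<omega>. \<beta> * X 0 \<omega>) \<omega> = g (sample_vector X N \<omega>)"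
      "c = g (restrict x {1..N})" by blast
    have "AE \<omega> in Q. g (sample_vector X N \<omega>) = \<beta> * loc_param X Q"
      using g(2) ce by eventually_elim simp
    then show "c = \<beta> * loc_param X Q"
      using continuous_version_unique[OF ind' pos g(1), of "\<lambda>_. \<beta> * loc_param X Q" x] g(3) by simp
  qed
qed

section \<open>Bounding the robust expectation by coercivity\<close>

text \<open>Linear growth outside \<open>{-K..K}\<close> means that a minimiser over this interval
  is a global one. The last conclusion says that \<open>C * \<bar>\<mu>\<bar>\<close> exceeds
  \<open>C * K\<close> by at most the excess of \<open>f\<close> over its minimum, which is what the
  divergence penalty has to absorb.\<close>

lemma coercive_minimiser:
  fixes f :: "real \<Rightarrow> real"
  assumes "C \<ge> 0" and "K \<ge> 0" and cont: "continuous_on {-K..K} f"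
    and right: "\<And>\<mu>. K \<le> \<mu> \<Longrightarrow> f K + C * (\<mu> - K) \<le> f \<mu>"
    and left: "\<And>\<mu>. \<mu> \<le> -K \<Longrightarrow> f (-K) + C * (-K - \<mu>) \<le> f \<mu>"
  obtains \<mu>\<^sub>0 where "\<bar>\<mu>\<^sub>0\<bar> \<le> K" and "\<And>\<mu>. f \<mu>\<^sub>0 \<le> f \<mu>"
    and "\<And>\<mu>. C * \<bar>\<mu>\<bar> \<le> C * K + (f \<mu> - f \<mu>\<^sub>0)"
proof -
  obtain \<mu>\<^sub>0 where \<mu>\<^sub>0: "\<mu>\<^sub>0 \<in> {-K..K}" and min: "\<And>\<mu>. \<mu> \<in> {-K..K} \<Longrightarrow> f \<mu>\<^sub>0 \<le> f \<mu>"
    using continuous_attains_inf[OF compact_Icc _ cont] \<open>K \<ge> 0\<close> by auto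
  \<comment> \<open>Comparing with \<open>C * max K \<bar>\<mu>\<bar>\<close> gives both conclusions
    at once: this quantity dominates \<open>C * \<bar>\<mu>\<bar>\<close> as well as
    \<open>C * K\<close>, and the latter yields minimality.\<close>
  have *: "C * \<bar>\<mu>\<bar> \<le> C * max K \<bar>\<mu>\<bar> \<and> C * max K \<bar>\<mu>\<bar> \<le> C * K + (f \<mu> - f \<mu>\<^sub>0)" for \<mu>
  proof -
    consider "\<mu> \<in> {-K..K}" | "K \<le> \<mu>" | "\<mu> \<le> -K" by force
    then have "C * max K \<bar>\<mu>\<bar> \<le> C * K + (f \<mu> - f \<mu>\<^sub>0)"
    proof cases
      case 1
      then have "max K \<bar>\<mu>\<bar> = K" by auto
      then show ?thesis using min[OF 1] by simp
    next
      case 2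
      then have "max K \<bar>\<mu>\<bar> = \<mu>" using \<open>K \<ge> 0\<close> by auto
      then show ?thesis using right[OF 2] min[of K] \<open>K \<ge> 0\<close> by (simp add: algebra_simps)
    next
      case 3
      then have "max K \<bar>\<mu>\<bar> = -\<mu>" using \<open>K \<ge> 0\<close> by auto
      then show ?thesis using left[OF 3] min[of "-K"] \<open>K \<ge> 0\<close> by (simp add: algebra_simps)
    qed
    then show ?thesis using \<open>C \<ge> 0\<close> by (auto intro: mult_left_mono)
  qed
  show thesis
  proof
    show "\<bar>\<mu>\<^sub>0\<bar> \<le> K" using \<mu>\<^sub>0 by auto
    fix \<mu>
    have "C * K \<le> C * max K \<bar>\<mu>\<bar>" using \<open>C \<ge> 0\<close> by (auto intro: mult_left_mono)
    then show "f \<mu>\<^sub>0 \<le> f \<mu>" and "C * \<bar>\<mu>\<bar> \<le> C * K + (f \<mu> - f \<mu>\<^sub>0)" using *[of \<mu>] by linarith+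
  qed
qed

lemma robust_expectation_bound:
  assumes der: "monotone_derivative \<Psi> \<psi>" and fam: "location_family \<Omega> \<Q> X N \<Psi>"
    and "k > 0" and "K \<ge> 0"
    and upper: "(\<Sum>n=1..N. \<psi> (z n - K)) \<le> - (k * \<bar>\<beta>\<bar>)"
    and lower: "k * \<bar>\<beta>\<bar> \<le> (\<Sum>n=1..N. \<psi> (z n + K))"
  shows "\<bar>robust_expectation \<Psi> X N \<Q> k (\<lambda>\<omega>. \<beta> * X 0 \<omega>) z\<bar> \<le> ereal (\<bar>\<beta>\<bar> * K)"
proof -
  define f where "f = (\<lambda>\<mu>. \<Sum>n=1..N. \<Psi> (z n - \<mu>))"
  have \<Psi>: "continuous_on UNIV \<Psi>" using der by (simp add: monotone_derivative_def)
  have cont: "continuous_on {-K..K} f"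
    unfolding f_def by (intro continuous_on_sum continuous_on_compose2[OF \<Psi>] continuous_intros) auto
  have right: "f K + k * \<bar>\<beta>\<bar> * (\<mu> - K) \<le> f \<mu>" if "K \<le> \<mu>" for \<mu>
  proof -
    \<comment> \<open>Each argument moves from \<open>z n - \<mu>\<close> up to
      \<open>z n - K\<close>; the score at the upper end bounds the increment from above.\<close>
    have "f K - f \<mu> \<le> (\<Sum>n=1..N. \<psi> (z n - K) * (\<mu> - K))"
      unfolding f_def sum_subtractf[symmetric] using that
      by (intro sum_mono order_trans[OF monotone_derivative_bounds(1)[OF der]]) auto
    also have "\<dots> \<le> - (k * \<bar>\<beta>\<bar>) * (\<mu> - K)"
      unfolding sum_distrib_right[symmetric] using that upper by (intro mult_right_mono) auto
    finally show ?thesis by simp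
  qed
  have left: "f (-K) + k * \<bar>\<beta>\<bar> * (-K - \<mu>) \<le> f \<mu>" if "\<mu> \<le> -K" for \<mu>
  proof -
    have "k * \<bar>\<beta>\<bar> * (-K - \<mu>) \<le> (\<Sum>n=1..N. \<psi> (z n + K) * (-K - \<mu>))"
      unfolding sum_distrib_right[symmetric] using that lower by (intro mult_right_mono) auto
    also have "\<dots> \<le> f \<mu> - f (-K)"
      unfolding f_def sum_subtractf[symmetric] using that
      by (intro sum_mono order_trans[OF _ monotone_derivative_bounds(2)[OF der]]) (auto simp: algebra_simps)
    finally show ?thesis by simp
  qed
  obtain \<mu>\<^sub>0 where \<mu>\<^sub>0: "\<bar>\<mu>\<^sub>0\<bar> \<le> K" and min: "\<And>\<mu>. f \<mu>\<^sub>0 \<le> f \<mu>"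
    and coer: "\<And>\<mu>. k * \<bar>\<beta>\<bar> * \<bar>\<mu>\<bar> \<le> k * \<bar>\<beta>\<bar> * K + (f \<mu> - f \<mu>\<^sub>0)"
    using coercive_minimiser[OF _ \<open>K \<ge> 0\<close> cont right left] \<open>k > 0\<close> by auto
  have surj: "loc_param X ` \<Q> = UNIV"
    using fam by (auto simp: location_family_def bij_betw_def)
  then obtain Q\<^sub>0 where Q\<^sub>0: "Q\<^sub>0 \<in> \<Q>" "loc_param X Q\<^sub>0 = \<mu>\<^sub>0" by (metis UNIV_I imageE)
  have lik: "ln (likelihood \<Psi> X N z Q) = - f (loc_param X Q)" for Q
    unfolding likelihood_def f_def exp_sum[OF finite_atLeastAtMost, symmetric] by (simp add: sum_negf)
  \<comment> \<open>The supremum of the log-likelihoods is attained at \<open>Q\<^sub>0\<close>, the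
    maximum likelihood measure, so every divergence is a real number.\<close>
  have "(SUP Q\<in>\<Q>. ereal (ln (likelihood \<Psi> X N z Q))) = ereal (- f \<mu>\<^sub>0)"
    using Q\<^sub>0 min by (intro antisym SUP_least SUP_upper2[of Q\<^sub>0]) (auto simp: lik)
  then have div: "divergence \<Psi> X N \<Q> z Q = ereal (f (loc_param X Q) - f \<mu>\<^sub>0)" for Q
    by (simp add: divergence_def lik)
  define T where "T = robust_expectation \<Psi> X N \<Q> k (\<lambda>\<omega>. \<beta> * X 0 \<omega>) z"
  have T: "T = (SUP Q\<in>\<Q>. ereal (\<beta> * loc_param X Q - (f (loc_param X Q) - f \<mu>\<^sub>0) / k))"
    unfolding T_def robust_expectation_def
    by (intro SUP_cong) (auto simp: div cond_expectation_at_location_family[OF fam])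
  have "T \<le> ereal (\<bar>\<beta>\<bar> * K)"
    unfolding T
  proof (rule SUP_least)
    fix Q
    let ?\<mu> = "loc_param X Q"
    have "\<bar>\<beta>\<bar> * \<bar>?\<mu>\<bar> \<le> \<bar>\<beta>\<bar> * K + (f ?\<mu> - f \<mu>\<^sub>0) / k"
      using coer[of ?\<mu>] \<open>k > 0\<close> by (simp add: field_simps)
    moreover have "\<beta> * ?\<mu> \<le> \<bar>\<beta>\<bar> * \<bar>?\<mu>\<bar>" by (metis abs_ge_self abs_mult)
    ultimately show "ereal (\<beta> * ?\<mu> - (f ?\<mu> - f \<mu>\<^sub>0) / k) \<le> ereal (\<bar>\<beta>\<bar> * K)" by simp
  qed
  moreover have "ereal (- (\<bar>\<beta>\<bar> * K)) \<le> T"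
  proof -
    \<comment> \<open>At \<open>Q\<^sub>0\<close> the divergence vanishes, so the expected payoff
      \<open>\<beta> * \<mu>\<^sub>0\<close> is a lower bound for the supremum.\<close>
    have "\<bar>\<beta> * \<mu>\<^sub>0\<bar> \<le> \<bar>\<beta>\<bar> * K" using \<mu>\<^sub>0 by (simp add: abs_mult mult_left_mono)
    then have "ereal (- (\<bar>\<beta>\<bar> * K)) \<le> ereal (\<beta> * \<mu>\<^sub>0)" by auto
    also have "\<dots> \<le> T" unfolding T using Q\<^sub>0 by (intro SUP_upper2[of Q\<^sub>0]) auto
    finally show ?thesis .
  qed
  ultimately show ?thesis unfolding T_def[symmetric] by (cases T) auto
qed

section \<open>Uniformity over contaminations\<close>

lemma contaminated_score_sum_upper:
  fixes \<psi> :: "real \<Rightarrow> real" and a :: ereal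
  assumes mono: "mono \<psi>" and lim: "((\<lambda>t. ereal (\<psi> t)) \<longlongrightarrow> a) at_bot"
    and "N \<ge> 1" and M: "M \<subseteq> {1..N}"
    and cases: "M = {} \<and> a < ereal (- C / N) \<or>
      (\<exists>A B. a = ereal A \<and> (\<forall>t. \<psi> t \<le> B) \<and>
        real (card M) * B + (real N - real (card M)) * A < - C)"
  shows "\<exists>K\<^sub>0. \<forall>K\<ge>K\<^sub>0. \<forall>y. (\<Sum>n=1..N. \<psi> (contaminate x M y n - K)) \<le> - C"
proof -
  let ?m = "real (card M)"
  obtain t B where B: "\<And>n s. n \<in> M \<Longrightarrow> \<psi> s \<le> B"
    and t: "?m * B + (real N - ?m) * \<psi> t \<le> - C"
    using cases
  proof (elim disjE conjE exE)
    assume "M = {}" and "a < ereal (- C / N)"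
    from order_tendstoD(2)[OF lim this(2)] obtain t where "\<psi> t < - C / N"
      by (auto dest!: eventually_happens)
    \<comment> \<open>With \<open>M\<close> empty, \<open>B\<close> is multiplied by zero, so any
      value serves.\<close>
    then show thesis using \<open>M = {}\<close> \<open>N \<ge> 1\<close> by (intro that[of 0 t]) (auto simp: field_simps)
  next
    fix A B
    assume A: "a = ereal A" and B: "\<forall>t. \<psi> t \<le> B" and less: "?m * B + (real N - ?m) * A < - C"
    have "(\<psi> \<longlongrightarrow> A) at_bot" using lim A by simp
    then have "((\<lambda>t. ?m * B + (real N - ?m) * \<psi> t) \<longlongrightarrow> ?m * B + (real N - ?m) * A) at_bot"
      by (intro tendsto_intros)
    from order_tendstoD(2)[OF this less] obtain t where "?m * B + (real N - ?m) * \<psi> t < - C"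
      by (auto dest!: eventually_happens)
    then show thesis using B by (intro that[of B t]) auto
  qed
  \<comment> \<open>The sum of the \<open>\<bar>x n\<bar>\<close> dominates each \<open>x n\<close>,
    so this single threshold gives \<open>x n - K \<le> t\<close> for all \<open>n\<close>.\<close>
  have "(\<Sum>n=1..N. \<psi> (contaminate x M y n - K)) \<le> - C" if K: "(\<Sum>n=1..N. \<bar>x n\<bar>) - t \<le> K" for K y
  proof -
    have "(\<Sum>n=1..N. \<psi> (contaminate x M y n - K)) \<le> (\<Sum>n=1..N. if n \<in> M then B else \<psi> t)"
    proof (rule sum_mono)
      fix n assume n: "n \<in> {1..N}"
      have "\<bar>x n\<bar> \<le> (\<Sum>n=1..N. \<bar>x n\<bar>)" using n by (intro member_le_sum) auto
      then have "x n - K \<le> t" using K by linarith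
      then show "\<psi> (contaminate x M y n - K) \<le> (if n \<in> M then B else \<psi> t)"
        using B monoD[OF mono] by (auto simp: contaminate_def)
    qed
    also have "\<dots> = ?m * B + (real N - ?m) * \<psi> t"
    proof -
      have "finite M" and "card M \<le> N" using M finite_subset card_mono[OF _ M] by auto
      have "{1..N} \<inter> {n. n \<in> M} = M" and "{1..N} \<inter> - {n. n \<in> M} = {1..N} - M" using M by auto
      then show ?thesis using M \<open>finite M\<close> \<open>card M \<le> N\<close>
        by (simp add: sum.If_cases card_Diff_subset of_nat_diff)
    qed
    finally show ?thesis using t by linarith
  qed
  then show ?thesis by blast
qed

text \<open>The first alternative gives finiteness at \<open>x\<close>, possibly with infinite
  limits of the score; the second is the breakdown condition \<open>m / N < \<delta>\<close> with
  denominators cleared.\<close>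

lemma contaminated_robust_expectation_bounded:
  fixes psi_bot psi_top :: ereal
  assumes N: "N \<ge> 1" and der: "monotone_derivative \<Psi> \<psi>"
    and bot: "((\<lambda>t. ereal (\<psi> t)) \<longlongrightarrow> psi_bot) at_bot"
    and top: "((\<lambda>t. ereal (\<psi> t)) \<longlongrightarrow> psi_top) at_top"
    and fam: "location_family \<Omega> \<Q> X N \<Psi>" and "k > 0" and M: "M \<subseteq> {1..N}"
    and cases: "M = {} \<and> psi_bot < ereal (- (k * \<bar>\<beta>\<bar>) / N) \<and> ereal (k * \<bar>\<beta>\<bar> / N) < psi_top \<or>
      (\<exists>A B. psi_bot = ereal A \<and> psi_top = ereal B \<and>
        real (card M) * B + (real N - real (card M)) * A < - (k * \<bar>\<beta>\<bar>) \<and>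
        k * \<bar>\<beta>\<bar> < real (card M) * A + (real N - real (card M)) * B)"
  shows "\<exists>b. \<forall>y. \<bar>robust_expectation \<Psi> X N \<Q> k (\<lambda>\<omega>. \<beta> * X 0 \<omega>) (contaminate x M y)\<bar> \<le> ereal b"
proof -
  have mono: "mono \<psi>" using der by (simp add: monotone_derivative_def)
  have top_ge: "ereal (\<psi> t) \<le> psi_top" for t
    using monoD[OF mono, of t]
    by (intro tendsto_lowerbound[OF top]) (auto intro: eventually_mono[OF eventually_ge_at_top[of t]])
  have bot_le: "psi_bot \<le> ereal (\<psi> t)" for t
    using monoD[OF mono, of _ t]
    by (intro tendsto_upperbound[OF bot]) (auto intro: eventually_mono[OF eventually_le_at_bot[of t]])
  have "\<exists>K\<^sub>0. \<forall>K\<ge>K\<^sub>0. \<forall>y. (\<Sum>n=1..N. \<psi> (contaminate x M y n - K)) \<le> - (k * \<bar>\<beta>\<bar>)"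
  proof (rule contaminated_score_sum_upper[OF mono bot N M])
    show "M = {} \<and> psi_bot < ereal (- (k * \<bar>\<beta>\<bar>) / N) \<or>
      (\<exists>A B. psi_bot = ereal A \<and> (\<forall>t. \<psi> t \<le> B) \<and>
        real (card M) * B + (real N - real (card M)) * A < - (k * \<bar>\<beta>\<bar>))"
      using cases
    proof (elim disjE conjE exE)
      fix A B
      assume "psi_bot = ereal A" "psi_top = ereal B"
        and "real (card M) * B + (real N - real (card M)) * A < - (k * \<bar>\<beta>\<bar>)"
      moreover from this have "\<forall>t. \<psi> t \<le> B" using top_ge by simp
      ultimately show ?thesis by blast
    qed simp
  qed
  then obtain K\<^sub>1 where K\<^sub>1: "\<And>K y. K\<^sub>1 \<le> K \<Longrightarrow>
      (\<Sum>n=1..N. \<psi> (contaminate x M y n - K)) \<le> - (k * \<bar>\<beta>\<bar>)" by blast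
  txt \<open>The lower bound is the upper bound for the reflected sample and the score \<open>\<lambda>t. - \<psi> (- t)\<close>.\<close>
  have mono': "mono (\<lambda>t. - \<psi> (- t))" using mono by (auto simp: mono_def)
  have bot': "((\<lambda>t. ereal (- \<psi> (- t))) \<longlongrightarrow> - psi_top) at_bot"
    using tendsto_uminus_ereal[OF filterlim_compose[OF top filterlim_uminus_at_top_at_bot]] by simp
  have "\<exists>K\<^sub>0. \<forall>K\<ge>K\<^sub>0. \<forall>y. (\<Sum>n=1..N. - \<psi> (- (contaminate (\<lambda>n. - x n) M y n - K))) \<le> - (k * \<bar>\<beta>\<bar>)"
  proof (rule contaminated_score_sum_upper[OF mono' bot' N M])
    show "M = {} \<and> - psi_top < ereal (- (k * \<bar>\<beta>\<bar>) / N) \<or>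
      (\<exists>A B. - psi_top = ereal A \<and> (\<forall>t. - \<psi> (- t) \<le> B) \<and>
        real (card M) * B + (real N - real (card M)) * A < - (k * \<bar>\<beta>\<bar>))"
      using cases
    proof (elim disjE conjE exE)
      assume "M = {}" "ereal (k * \<bar>\<beta>\<bar> / N) < psi_top"
      then show ?thesis using ereal_minus_less_minus[of psi_top "ereal (k * \<bar>\<beta>\<bar> / N)"] by simp
    next
      fix A B
      assume AB: "psi_bot = ereal A" "psi_top = ereal B"
        and less: "k * \<bar>\<beta>\<bar> < real (card M) * A + (real N - real (card M)) * B"
      \<comment> \<open>Reflection exchanges the limits: the new score tends to \<open>- B\<close>
        at minus infinity and is bounded above by \<open>- A\<close>.\<close>
      have "\<forall>t. - \<psi> (- t) \<le> - A" using bot_le AB(1) by simp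
      moreover have "real (card M) * (- A) + (real N - real (card M)) * (- B) < - (k * \<bar>\<beta>\<bar>)"
        using less by (simp add: algebra_simps)
      ultimately show ?thesis
        using AB(2) by (intro disjI2 exI[of _ "- B"] exI[of _ "- A"]) auto
    qed
  qed
  then obtain K\<^sub>2 where K\<^sub>2: "\<And>K y. K\<^sub>2 \<le> K \<Longrightarrow>
      (\<Sum>n=1..N. - \<psi> (- (contaminate (\<lambda>n. - x n) M y n - K))) \<le> - (k * \<bar>\<beta>\<bar>)" by blast
  define K where "K = max 0 (max K\<^sub>1 K\<^sub>2)"
  have "\<bar>robust_expectation \<Psi> X N \<Q> k (\<lambda>\<omega>. \<beta> * X 0 \<omega>) (contaminate x M y)\<bar> \<le> ereal (\<bar>\<beta>\<bar> * K)" for y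
  proof (rule robust_expectation_bound[OF der fam \<open>k > 0\<close>])
    show "K \<ge> 0" by (simp add: K_def)
    show "(\<Sum>n=1..N. \<psi> (contaminate x M y n - K)) \<le> - (k * \<bar>\<beta>\<bar>)"
      by (rule K\<^sub>1) (simp add: K_def)
    have reflect: "- (contaminate (\<lambda>n. - x n) M (\<lambda>n. - y n) n - K) = contaminate x M y n + K" for n
      by (simp add: contaminate_def)
    have "K\<^sub>2 \<le> K" by (simp add: K_def)
    from K\<^sub>2[OF this, of "\<lambda>n. - y n"]
    show "k * \<bar>\<beta>\<bar> \<le> (\<Sum>n=1..N. \<psi> (contaminate x M y n + K))"
      unfolding reflect by (simp add: sum_negf)
  qed
  then show ?thesis by blast
qed

theorem theorem9:
  fixes \<Omega> :: "'w measure" and \<Q> :: "'w measure set" and X :: "nat \<Rightarrow> 'w \<Rightarrow> real"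
    and \<Psi> \<psi> :: "real \<Rightarrow> real" and psi_bot psi_top :: ereal
    and N :: nat and k \<beta> :: real and x :: "nat \<Rightarrow> real"
  assumes "N \<ge> 1"
    and "monotone_derivative \<Psi> \<psi>"
    and "((\<lambda>t. ereal (\<psi> t)) \<longlongrightarrow> psi_bot) at_bot"
    and "((\<lambda>t. ereal (\<psi> t)) \<longlongrightarrow> psi_top) at_top"
    and "psi_bot < 0" and "0 < psi_top"
    and "location_family \<Omega> \<Q> X N \<Psi>"
    and "k > 0"
    and "psi_bot < ereal (k * \<beta> / N)" and "ereal (k * \<beta> / N) < psi_top"
    and "psi_bot < ereal (- (k * \<beta> / N))" and "ereal (- (k * \<beta> / N)) < psi_top"
  shows "\<bar>robust_expectation \<Psi> X N \<Q> k (\<lambda>\<omega>. \<beta> * X 0 \<omega>) x\<bar> \<noteq> \<infinity> \<and>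
    breakdown_fraction_at_least N (robust_expectation \<Psi> X N \<Q> k (\<lambda>\<omega>. \<beta> * X 0 \<omega>)) x
      (breakdown_bound psi_bot psi_top (k * \<bar>\<beta>\<bar> / N))"
proof
  let ?T = "robust_expectation \<Psi> X N \<Q> k (\<lambda>\<omega>. \<beta> * X 0 \<omega>)"
  note bounded = contaminated_robust_expectation_bounded[OF assms(1-4,7,8)]
  \<comment> \<open>The hypotheses for both signs of \<open>\<beta>\<close> cover the slope with the
    absolute value, whichever sign it stands for.\<close>
  have "k * \<bar>\<beta>\<bar> / N = k * \<beta> / N \<or> k * \<bar>\<beta>\<bar> / N = - (k * \<beta> / N)" by (cases "\<beta> \<ge> 0") auto
  then have slopes: "psi_bot < ereal (- (k * \<bar>\<beta>\<bar>) / N)" "ereal (k * \<bar>\<beta>\<bar> / N) < psi_top"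
    using assms(9-12) by auto
  have uncontaminated: "\<exists>b. \<forall>y. \<bar>?T (contaminate x {} y)\<bar> \<le> ereal b"
    using slopes by (intro bounded) auto
  then show "\<bar>?T x\<bar> \<noteq> \<infinity>" by (auto simp: contaminate_def)
  show "breakdown_fraction_at_least N ?T x (breakdown_bound psi_bot psi_top (k * \<bar>\<beta>\<bar> / N))"
    unfolding breakdown_fraction_at_least_def
  proof (intro allI impI, elim conjE)
    fix M
    assume M: "M \<subseteq> {1..N}"
      and less: "real (card M) / real N < breakdown_bound psi_bot psi_top (k * \<bar>\<beta>\<bar> / N)"
    \<comment> \<open>No fraction of observations is negative, so an infinite limit, where the bound
      is read as zero, leaves nothing to prove.\<close>
    have "\<not> real (card M) / real N < 0" by (simp add: not_less)
    then have "psi_bot \<noteq> -\<infinity>" "psi_top \<noteq> \<infinity>"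
      using less by (auto simp: breakdown_bound_def split: if_splits)
    then obtain A B where AB: "psi_bot = ereal A" "psi_top = ereal B"
      using assms(5,6) by (cases psi_bot; cases psi_top) auto
    have "B - A > 0" and "real N > 0" using AB assms(1,5,6) by auto
    have "real (card M) / N < (B - k * \<bar>\<beta>\<bar> / N) / (B - A)"
      and "real (card M) / N < (- (k * \<bar>\<beta>\<bar> / N) - A) / (B - A)"
      using less AB by (auto simp: breakdown_bound_def)
    \<comment> \<open>With \<open>m\<close> for \<open>card M\<close>, the first inequality
      rearranges to \<open>k * \<bar>\<beta>\<bar> < m * A + (N - m) * B\<close>, the second to
      \<open>m * B + (N - m) * A < - (k * \<bar>\<beta>\<bar>)\<close>.\<close>
    then have "real (card M) * (B - A) < (B - k * \<bar>\<beta>\<bar> / N) * N"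
      and "real (card M) * (B - A) < (- (k * \<bar>\<beta>\<bar> / N) - A) * N"
      using \<open>B - A > 0\<close> \<open>real N > 0\<close> by (simp_all add: pos_divide_less_eq pos_less_divide_eq mult.commute)
    moreover have "(B - k * \<bar>\<beta>\<bar> / N) * N = B * N - k * \<bar>\<beta>\<bar>"
      and "(- (k * \<bar>\<beta>\<bar> / N) - A) * N = - (k * \<bar>\<beta>\<bar>) - A * N"
      using \<open>real N > 0\<close> by (simp_all add: field_simps)
    ultimately show "\<exists>b. \<forall>y. \<bar>?T (contaminate x M y)\<bar> \<le> ereal b"
      using AB by (intro bounded[OF M]) (auto simp: algebra_simps)
  qed
qed

end
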